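(* For a positive integer $n$ let $a(n)$ be the maximum of $|S|$ over all subsets $S\subseteq\{0,1,\dots,n-1\}^3$ such that no three distinct points of $S$ are collinear. Then $$a(7)\ge 73,\quad a(8)\ge 94,\quad a(9)\ge 116,\quad a(10)\ge 138,\quad a(11)\ge 164.$$
   Context: Collinearity is in the usual sense of $\mathbb{R}^3$: three distinct points are collinear if some (arbitrary, not necessarily axis-parallel) straight line of $\mathbb{R}^3$ contains all three. *)

theory Defs
  imports "HOL-Analysis.Analysis"
begin

definition grid :: "nat \<Rightarrow> (real ^ 3) set" where
  "grid n = {x. \<forall>i. x $ i \<in> real ` {0..<n}}"

definition no_three_collinear :: "(real ^ 3) set \<Rightarrow> bool" where
  "no_three_collinear S \<longleftrightarrow>
     (\<forall>x\<in>S. \<forall>y\<in>S. \<forall>z\<in>S. x \<noteq> y \<and> x \<noteq> z \<and> y \<noteq> z \<longrightarrow> \<not> collinear {x, y, z})"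

definition max_no_three_collinear :: "nat \<Rightarrow> nat" where
  "max_no_three_collinear n = Max {card S | S. S \<subseteq> grid n \<and> no_three_collinear S}"

text \<open>The following facts guarantee that the maximum above is a genuine one:
  \<open>Max\<close> is unspecified on infinite or empty sets, and \<open>card\<close> is 0 on infinite sets.\<close>

lemma finite_grid: "finite (grid n)"
proof -
  have "grid n \<subseteq> vec_lambda ` (UNIV \<rightarrow>\<^sub>E real ` {0..<n})"
  proof
    fix x assume "x \<in> grid n"
    then have "vec_nth x \<in> UNIV \<rightarrow>\<^sub>E real ` {0..<n}"
      by (auto simp: grid_def PiE_def)
    then show "x \<in> vec_lambda ` (UNIV \<rightarrow>\<^sub>E real ` {0..<n})"
      by (rule rev_image_eqI) simp
  qed
  moreover have "finite (vec_lambda ` ((UNIV :: 3 set) \<rightarrow>\<^sub>E real ` {0..<n}))"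
    by (intro finite_imageI finite_PiE) auto
  ultimately show ?thesis by (rule finite_subset)
qed

lemma finite_cards: "finite {card S | S. S \<subseteq> grid n \<and> no_three_collinear S}"
  using finite_grid[of n] by simp

lemma cards_nonempty: "{card S | S. S \<subseteq> grid n \<and> no_three_collinear S} \<noteq> {}"
proof -
  have "no_three_collinear {}" by (simp add: no_three_collinear_def)
  then show ?thesis by blast
qed

end

theory Submission
  imports Defs
begin

(* The bounds are witnessed by explicit point sets, found by simulated annealing among sets invariant
   under a group of symmetries of the cube. A set has no three collinear points if, seen from each of its
   points, the later points of a fixed enumeration lie in pairwise non-parallel directions. Parallel
   integer vectors u have the same value of |l u| div gcd u for every integral linear form l, so it
   suffices that these values are pairwise distinct; this is n^2/2 short computations instead of
   n^3/6 determinants. *)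

section \<open>Keys of directions\<close>

(* Base 21 makes the form injective on differences of points of a cube of side at most 11. *)

definition direction_key :: "int \<times> int \<times> int \<Rightarrow> int" where
  "direction_key = (\<lambda>(a, b, c). \<bar>441 * a + 21 * b + c\<bar> div gcd a (gcd b c))"

(* Most of the gcds are 1, and these two code equations shortcut that case. *)

lemma gcd_int_code [code]:
  "gcd k (l::int) = (if l = 0 then \<bar>k\<bar> else if l = 1 then 1 else if l = -1 then 1
     else gcd l (k mod l))"
  by (auto simp: gcd_red_int[symmetric])

lemma direction_key_code [code]:
  "direction_key (a, b, c) =
     (let g = gcd a (gcd b c); s = \<bar>441 * a + 21 * b + c\<bar> in if g = 1 then s else s div g)"
  by (simp add: direction_key_def Let_def)

text \<open>Pulls a scalar through the threefold gcd; below, the scalars are the values of the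
  linear form at two parallel vectors.\<close>

lemma gcd3_mult_abs: "\<bar>k\<bar> * gcd a (gcd b c) = gcd (k * a) (gcd (k * b) (k * (c::int)))"
proof -
  have "gcd (k * b) (k * c) = \<bar>k * gcd b c\<bar>"
    by (simp add: abs_mult gcd_mult_distrib_int)
  then show ?thesis
    by (simp add: gcd_mult_distrib_int)
qed

text \<open>The equations say that u = (a, b, c) and u' = (a', b', c') have zero cross product. As l
  is linear, they give l(u') u = l(u) u', and taking gcds of coordinates gives |l(u')| gcd u =
  |l(u)| gcd u'. Dividing by both gcds, which are nonzero because the vectors are, yields the
  claim.\<close>

lemma direction_key_parallel:
  assumes "a * b' = a' * b" "a * c' = a' * c" "b * c' = b' * c"
    and "(a, b, c) \<noteq> (0, 0, 0)" "(a', b', c') \<noteq> (0, 0, 0)"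
  shows "direction_key (a, b, c) = direction_key (a', b', c')"
proof -
  define l where "l = 441 * a + 21 * b + c"
  define l' where "l' = 441 * a' + 21 * b' + c'"
  define g where "g = gcd a (gcd b c)"
  define g' where "g' = gcd a' (gcd b' c')"
  have "l' * a = l * a'" "l' * b = l * b'" "l' * c = l * c'"
    using assms(1-3) unfolding l_def l'_def by (simp_all add: algebra_simps)
  then have eq: "\<bar>l'\<bar> * g = \<bar>l\<bar> * g'"
    unfolding g_def g'_def gcd3_mult_abs by simp
  have "g \<noteq> 0" "g' \<noteq> 0"
    using assms(4,5) by (auto simp: g_def g'_def)
  have g_dvd: "g dvd a" "g dvd b" "g dvd c"
    unfolding g_def by (meson dvd_refl gcd_dvd1 gcd_dvd2 dvd_trans)+
  have g'_dvd: "g' dvd a'" "g' dvd b'" "g' dvd c'"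
    unfolding g'_def by (meson dvd_refl gcd_dvd1 gcd_dvd2 dvd_trans)+
  \<comment> \<open>Both divisions in the keys are exact, so cancelling \<open>g * g'\<close> in
    \<open>eq\<close> leaves m = m'.\<close>
  have "g dvd \<bar>l\<bar>" "g' dvd \<bar>l'\<bar>"
    unfolding l_def l'_def using g_dvd g'_dvd by simp_all
  then obtain m m' where "\<bar>l\<bar> = g * m" "\<bar>l'\<bar> = g' * m'"
    by (elim dvdE)
  with eq \<open>g \<noteq> 0\<close> \<open>g' \<noteq> 0\<close> have "\<bar>l\<bar> div g = \<bar>l'\<bar> div g'"
    by (simp add: mult.assoc mult.left_commute)
  then show ?thesis
    by (simp add: direction_key_def l_def l'_def g_def g'_def)
qed

section \<open>Distinctness by insertion into binary tries\<close>

text \<open>A set of binary numerals: a key is a path, read from the least significant digit and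
  ended by \<open>num.One\<close>, and the flag of a node tells whether the key ending there is
  present. The cost of a lookup is bounded by the length of the key, however many keys are
  stored.\<close>

datatype trie = Empty | Node bool trie trie

fun trie_member :: "num \<Rightarrow> trie \<Rightarrow> bool" where
  "trie_member k Empty = False"
| "trie_member num.One (Node b l r) = b"
| "trie_member (num.Bit0 k) (Node b l r) = trie_member k l"
| "trie_member (num.Bit1 k) (Node b l r) = trie_member k r"

fun trie_insert :: "num \<Rightarrow> trie \<Rightarrow> trie" where
  "trie_insert num.One Empty = Node True Empty Empty"
| "trie_insert (num.Bit0 k) Empty = Node False (trie_insert k Empty) Empty"
| "trie_insert (num.Bit1 k) Empty = Node False Empty (trie_insert k Empty)"
| "trie_insert num.One (Node b l r) = Node True l r"
| "trie_insert (num.Bit0 k) (Node b l r) = Node b (trie_insert k l) r"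
| "trie_insert (num.Bit1 k) (Node b l r) = Node b l (trie_insert k r)"

lemma trie_member_insert: "trie_member j (trie_insert k t) \<longleftrightarrow> j = k \<or> trie_member j t"
proof (induction k t arbitrary: j rule: trie_insert.induct)
qed (case_tac j; simp)+

fun fresh_keys :: "trie \<Rightarrow> num list \<Rightarrow> bool" where
  "fresh_keys t [] \<longleftrightarrow> True"
| "fresh_keys t (k # ks) \<longleftrightarrow> \<not> trie_member k t \<and> fresh_keys (trie_insert k t) ks"

lemma fresh_keys_iff:
  "fresh_keys t ks \<longleftrightarrow> distinct ks \<and> (\<forall>k\<in>set ks. \<not> trie_member k t)"
  by (induction t ks rule: fresh_keys.induct) (auto simp: trie_member_insert)

text \<open>Keys are nonnegative, and 0 and 1 both become \<open>num.One\<close>. Such a collision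
  can only make the check fail: soundness rests on parallel directions receiving equal keys.\<close>

definition num_of_int :: "int \<Rightarrow> num" where
  "num_of_int k = num_of_nat (nat k)"

lemma num_of_int_code [code]:
  "num_of_int 0 = num.One"
  "num_of_int (Int.Pos n) = n"
  "num_of_int (Int.Neg n) = num.One"
  by (simp_all add: num_of_int_def num_of_nat_numeral_eq)

section \<open>The checker and its soundness\<close>

definition view_key :: "int \<times> int \<times> int \<Rightarrow> int \<times> int \<times> int \<Rightarrow> num" where
  "view_key = (\<lambda>(a, b, c) (d, e, f). num_of_int (direction_key (d - a, e - b, f - c)))"

fun distinct_directions :: "(int \<times> int \<times> int) list \<Rightarrow> bool" where
  "distinct_directions [] \<longleftrightarrow> True"
| "distinct_directions (p # ps) \<longleftrightarrow>
     fresh_keys Empty (map (view_key p) ps) \<and> distinct_directions ps"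

definition in_cube :: "int \<Rightarrow> int \<times> int \<times> int \<Rightarrow> bool" where
  "in_cube m = (\<lambda>(a, b, c). 0 \<le> a \<and> a < m \<and> 0 \<le> b \<and> b < m \<and> 0 \<le> c \<and> c < m)"

definition to_vec :: "int \<times> int \<times> int \<Rightarrow> real ^ 3" where
  "to_vec = (\<lambda>(a, b, c). vector [real_of_int a, real_of_int b, real_of_int c])"

lemma to_vec_nth [simp]:
  "to_vec (a, b, c) $ 1 = a" "to_vec (a, b, c) $ 2 = b" "to_vec (a, b, c) $ 3 = c"
  by (simp_all add: to_vec_def)

lemma inj_to_vec: "inj to_vec"
proof (rule injI)
  fix p q assume "to_vec p = to_vec q"
  then show "p = q"
    by (cases p; cases q) (simp add: vec_eq_iff forall_3)
qed

lemma to_vec_in_grid: "in_cube m p \<Longrightarrow> to_vec p \<in> grid (nat m)"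
proof (cases p)
  case (fields a b c)
  have coord: "real_of_int x \<in> real ` {0..<nat m}" if "0 \<le> x" "x < m" for x
    using that by (intro image_eqI[of _ _ "nat x"]) auto
  assume "in_cube m p"
  then show ?thesis
    by (simp add: fields in_cube_def grid_def forall_3 coord)
qed

text \<open>With \<open>p\<close> as origin, collinearity makes one direction a real multiple of the
  other; eliminating the real factor leaves the integer identities of
  \<open>direction_key_parallel\<close>.\<close>

lemma collinear_view_key:
  assumes "collinear {to_vec p, to_vec q, to_vec r}" and "q \<noteq> p" "r \<noteq> p"
  shows "view_key p q = view_key p r"
proof -
  obtain a b c where p: "p = (a, b, c)" by (cases p)
  obtain d e f where q: "q = (d, e, f)" by (cases q)
  obtain x y z where r: "r = (x, y, z)" by (cases r)
  \<comment> \<open>\<open>collinear_3\<close> takes the middle point as origin, so \<open>p\<close>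
    is moved there.\<close>
  have "collinear {to_vec q, to_vec p, to_vec r}"
    using assms(1) by (simp add: insert_commute)
  then have "collinear {0, to_vec q - to_vec p, to_vec r - to_vec p}"
    by (subst (asm) collinear_3) simp
  moreover have "to_vec q - to_vec p \<noteq> 0" "to_vec r - to_vec p \<noteq> 0"
    using assms(2,3) inj_to_vec by (auto dest: injD)
  ultimately obtain k where k: "to_vec r - to_vec p = k *\<^sub>R (to_vec q - to_vec p)"
    by (auto simp: collinear_lemma)
  have "real_of_int (x - a) = k * real_of_int (d - a)"
    "real_of_int (y - b) = k * real_of_int (e - b)"
    "real_of_int (z - c) = k * real_of_int (f - c)"
    using arg_cong[OF k, of "\<lambda>v. v $ 1"] arg_cong[OF k, of "\<lambda>v. v $ 2"]
      arg_cong[OF k, of "\<lambda>v. v $ 3"] by (simp_all add: p q r)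
  \<comment> \<open>Each side is \<open>k\<close> times a product of two coordinates of q - p. The
    equations descend from the reals to the integers because \<open>real_of_int\<close> is
    injective.\<close>
  then have "real_of_int ((d - a) * (y - b)) = real_of_int ((x - a) * (e - b))"
    "real_of_int ((d - a) * (z - c)) = real_of_int ((x - a) * (f - c))"
    "real_of_int ((e - b) * (z - c)) = real_of_int ((y - b) * (f - c))"
    unfolding of_int_mult by simp_all
  then have "direction_key (d - a, e - b, f - c) = direction_key (x - a, y - b, z - c)"
    using assms(2,3) unfolding of_int_eq_iff
    by (intro direction_key_parallel) (auto simp: p q r)
  then show ?thesis
    by (simp add: view_key_def p q r)
qed

text \<open>Of the three points, the one listed first sees the other two under different keys. In
  the induction, either the head is one of the three or all three lie in the tail.\<close>

lemma distinct_directions_not_collinear: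
  assumes "distinct_directions ps" "{p, q, r} \<subseteq> set ps" "p \<noteq> q" "p \<noteq> r" "q \<noteq> r"
  shows "\<not> collinear {to_vec p, to_vec q, to_vec r}"
  using assms
proof (induction ps)
  case Nil
  then show ?case by simp
next
  case (Cons s ps)
  have no_view: "\<not> collinear {to_vec s, to_vec u, to_vec v}"
    if "u \<in> set ps" "v \<in> set ps" "u \<noteq> v" "u \<noteq> s" "v \<noteq> s" for u v
  proof
    assume "collinear {to_vec s, to_vec u, to_vec v}"
    then have "view_key s u = view_key s v"
      using that by (intro collinear_view_key)
    \<comment> \<open>Freshness starting from \<open>Empty\<close> is plain distinctness of the keys
      seen from \<open>s\<close>.\<close>
    moreover have "inj_on (view_key s) (set ps)"
      using Cons.prems(1) by (simp add: fresh_keys_iff distinct_map)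
    ultimately show False
      using that by (auto dest: inj_onD)
  qed
  consider "s = p" | "s = q" | "s = r" | "s \<notin> {p, q, r}" by blast
  then show ?case
  proof cases
    case 1
    then show ?thesis using no_view[of q r] Cons.prems by auto
  next
    case 2
    then show ?thesis using no_view[of p r] Cons.prems by (auto simp: insert_commute)
  next
    case 3
    then show ?thesis using no_view[of p q] Cons.prems by (auto simp: insert_commute)
  next
    case 4
    then show ?thesis using Cons by auto
  qed
qed

lemma max_no_three_collinear_ge:
  assumes "distinct_directions ps" "distinct ps" "list_all (in_cube m) ps"
  shows "length ps \<le> max_no_three_collinear (nat m)"
proof -
  define S where "S = to_vec ` set ps"
  have "S \<subseteq> grid (nat m)"
    using assms(3) by (auto simp: S_def list_all_iff to_vec_in_grid)
  moreover have "no_three_collinear S"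
    unfolding no_three_collinear_def S_def ball_simps
    by (intro ballI impI distinct_directions_not_collinear[OF assms(1)]) auto
  moreover have "card S = length ps"
    unfolding S_def using assms(2) inj_to_vec
    by (simp add: card_image inj_on_subset distinct_card)
  ultimately show ?thesis
    unfolding max_no_three_collinear_def by (intro Max_ge finite_cards CollectI exI[of _ S]) simp
qed

section \<open>The point sets\<close>

text \<open>Invariant under all permutations of the coordinates.\<close>

definition points7 :: "(int \<times> int \<times> int) list" where
  "points7 =
    [(0,0,2), (0,0,6), (0,1,2), (0,1,4), (0,2,0), (0,2,1), (0,3,4), (0,3,5), (0,4,1), (0,4,3),
     (0,5,3), (0,5,5), (0,6,0), (1,0,2), (1,0,4), (1,1,5), (1,2,0), (1,2,3), (1,3,2), (1,3,6),
     (1,4,0), (1,4,6), (1,5,1), (1,6,3), (1,6,4), (2,0,0), (2,0,1), (2,1,0), (2,1,3), (2,3,1),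
     (2,4,6), (2,5,6), (2,6,4), (2,6,5), (3,0,4), (3,0,5), (3,1,2), (3,1,6), (3,2,1), (3,3,5),
     (3,4,0), (3,5,0), (3,5,3), (3,6,1), (4,0,1), (4,0,3), (4,1,0), (4,1,6), (4,2,6), (4,3,0),
     (4,5,5), (4,6,1), (4,6,2), (5,0,3), (5,0,5), (5,1,1), (5,2,6), (5,3,0), (5,3,3), (5,4,5),
     (5,5,0), (5,5,4), (5,6,2), (6,0,0), (6,1,3), (6,1,4), (6,2,4), (6,2,5), (6,3,1), (6,4,1),
     (6,4,2), (6,5,2), (6,6,6)]"

text \<open>Invariant under exchange of the last two coordinates.\<close>

definition points8 :: "(int \<times> int \<times> int) list" where
  "points8 =
    [(0,0,1), (0,1,0), (0,1,4), (0,2,2), (0,2,4), (0,3,5), (0,3,6), (0,4,1), (0,4,2), (0,5,3),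
     (0,5,5), (0,6,3), (0,6,7), (0,7,6), (1,0,0), (1,0,5), (1,1,3), (1,2,7), (1,3,1), (1,3,4),
     (1,4,3), (1,4,6), (1,5,0), (1,6,4), (1,7,2), (1,7,7), (2,0,3), (2,0,6), (2,1,1), (2,1,7),
     (2,3,0), (2,3,4), (2,4,3), (2,4,7), (2,6,0), (2,6,6), (2,7,1), (2,7,4), (3,0,0), (3,0,2),
     (3,1,2), (3,1,6), (3,2,0), (3,2,1), (3,5,6), (3,5,7), (3,6,1), (3,6,5), (3,7,5), (3,7,7),
     (4,0,4), (4,0,6), (4,1,7), (4,3,7), (4,4,0), (4,6,0), (4,7,1), (4,7,3), (5,0,1), (5,0,2),
     (5,1,0), (5,1,5), (5,2,0), (5,2,6), (5,5,1), (5,5,7), (5,6,2), (5,6,7), (5,7,5), (5,7,6),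
     (6,0,4), (6,1,1), (6,1,2), (6,2,1), (6,2,5), (6,3,7), (6,4,0), (6,5,2), (6,5,6), (6,6,5),
     (6,6,6), (6,7,3), (7,0,5), (7,1,3), (7,1,5), (7,2,6), (7,2,7), (7,3,1), (7,4,6), (7,5,0),
     (7,5,1), (7,6,2), (7,6,4), (7,7,2)]"

text \<open>Invariant under exchange of the last two coordinates and under reflection in the centre
  of the cube.\<close>

definition points9 :: "(int \<times> int \<times> int) list" where
  "points9 =
    [(0,1,3), (0,2,5), (0,2,6), (0,3,1), (0,3,3), (0,4,5), (0,4,7), (0,5,2), (0,5,4), (0,6,2),
     (0,7,4), (0,7,8), (0,8,7), (0,8,8), (1,0,5), (1,1,2), (1,1,6), (1,2,1), (1,2,2), (1,3,7),
     (1,4,8), (1,5,0), (1,5,6), (1,6,1), (1,6,5), (1,7,3), (1,8,4), (1,8,8), (2,0,2), (2,0,3),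
     (2,1,6), (2,1,7), (2,2,0), (2,2,8), (2,3,0), (2,5,7), (2,6,1), (2,7,1), (2,7,5), (2,8,2),
     (3,0,5), (3,0,7), (3,1,1), (3,2,8), (3,3,3), (3,3,5), (3,4,8), (3,5,0), (3,5,3), (3,6,7),
     (3,7,0), (3,7,6), (3,8,2), (3,8,4), (4,0,1), (4,0,3), (4,1,0), (4,3,0), (4,5,8), (4,7,8),
     (4,8,5), (4,8,7), (5,0,4), (5,0,6), (5,1,2), (5,1,8), (5,2,1), (5,3,5), (5,3,8), (5,4,0),
     (5,5,3), (5,5,5), (5,6,0), (5,7,7), (5,8,1), (5,8,3), (6,0,6), (6,1,3), (6,1,7), (6,2,7),
     (6,3,1), (6,5,8), (6,6,0), (6,6,8), (6,7,1), (6,7,2), (6,8,5), (6,8,6), (7,0,0), (7,0,4),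
     (7,1,5), (7,2,3), (7,2,7), (7,3,2), (7,3,8), (7,4,0), (7,5,1), (7,6,6), (7,6,7), (7,7,2),
     (7,7,6), (7,8,3), (8,0,0), (8,0,1), (8,1,0), (8,1,4), (8,2,6), (8,3,4), (8,3,6), (8,4,1),
     (8,4,3), (8,5,5), (8,5,7), (8,6,2), (8,6,3), (8,7,5)]"

text \<open>The same two symmetries as for \<open>points9\<close>, with the centre of the larger
  cube.\<close>

definition points10 :: "(int \<times> int \<times> int) list" where
  "points10 =
    [(0,1,4), (0,1,5), (0,2,2), (0,2,8), (0,3,5), (0,3,9), (0,4,1), (0,4,7), (0,5,1), (0,5,3),
     (0,6,7), (0,6,8), (0,7,4), (0,7,6), (0,8,2), (0,8,6), (0,9,3), (1,0,4), (1,0,5), (1,1,1),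
     (1,1,8), (1,2,8), (1,2,9), (1,3,3), (1,3,5), (1,4,0), (1,5,0), (1,5,3), (1,6,7), (1,6,9),
     (1,7,6), (1,8,1), (1,8,2), (1,9,2), (1,9,6), (2,0,1), (2,0,7), (2,1,0), (2,1,1), (2,4,9),
     (2,6,8), (2,6,9), (2,7,0), (2,8,6), (2,9,4), (2,9,6), (3,0,0), (3,0,4), (3,1,4), (3,1,6),
     (3,4,0), (3,4,1), (3,6,1), (3,7,8), (3,7,9), (3,8,7), (3,8,9), (3,9,7), (3,9,8), (4,0,2),
     (4,0,8), (4,1,9), (4,2,0), (4,3,8), (4,3,9), (4,8,0), (4,8,3), (4,9,1), (4,9,3), (5,0,6),
     (5,0,8), (5,1,6), (5,1,9), (5,6,0), (5,6,1), (5,7,9), (5,8,0), (5,9,1), (5,9,7), (6,0,1),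
     (6,0,2), (6,1,0), (6,1,2), (6,2,0), (6,2,1), (6,3,8), (6,5,8), (6,5,9), (6,8,3), (6,8,5),
     (6,9,5), (6,9,9), (7,0,3), (7,0,5), (7,1,3), (7,2,9), (7,3,0), (7,3,1), (7,5,0), (7,8,8),
     (7,8,9), (7,9,2), (7,9,8), (8,0,3), (8,0,7), (8,1,7), (8,1,8), (8,2,3), (8,3,0), (8,3,2),
     (8,4,6), (8,4,9), (8,5,9), (8,6,4), (8,6,6), (8,7,0), (8,7,1), (8,8,1), (8,8,8), (8,9,4),
     (8,9,5), (9,0,6), (9,1,3), (9,1,7), (9,2,3), (9,2,5), (9,3,1), (9,3,2), (9,4,6), (9,4,8),
     (9,5,2), (9,5,8), (9,6,0), (9,6,4), (9,7,1), (9,7,7), (9,8,4), (9,8,5)]"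

text \<open>Invariant under exchange of the first two coordinates and under reflection in the centre
  of the cube.\<close>

definition points11 :: "(int \<times> int \<times> int) list" where
  "points11 =
    [(0,0,3), (0,0,7), (0,1,3), (0,1,7), (0,2,9), (0,3,0), (0,3,1), (0,4,5), (0,5,4), (0,5,5),
     (0,6,8), (0,6,9), (0,7,0), (0,7,1), (0,8,6), (0,8,8), (0,9,2), (0,9,6), (1,0,3), (1,0,7),
     (1,1,1), (1,2,6), (1,2,9), (1,3,0), (1,3,6), (1,4,10), (1,5,7), (1,6,2), (1,6,3), (1,7,0),
     (1,7,5), (1,8,9), (1,8,10), (1,9,2), (1,9,8), (1,10,4), (1,10,8), (2,0,9), (2,1,6), (2,1,9),
     (2,2,4), (2,2,10), (2,3,8), (2,4,2), (2,4,10), (2,6,1), (2,7,8), (2,8,3), (2,8,7), (2,9,0),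
     (2,9,1), (2,10,2), (2,10,4), (3,0,0), (3,0,1), (3,1,0), (3,1,6), (3,2,8), (3,5,9), (3,6,1),
     (3,8,2), (3,9,5), (3,9,10), (3,10,9), (3,10,10), (4,0,5), (4,1,10), (4,2,2), (4,2,10), (4,5,0),
     (4,7,9), (4,8,9), (4,9,7), (4,9,8), (4,10,1), (4,10,2), (5,0,4), (5,0,5), (5,1,7), (5,3,9),
     (5,4,0), (5,5,0), (5,5,10), (5,6,10), (5,7,1), (5,9,3), (5,10,5), (5,10,6), (6,0,8), (6,0,9),
     (6,1,2), (6,1,3), (6,2,1), (6,3,1), (6,5,10), (6,8,0), (6,8,8), (6,9,0), (6,10,5), (7,0,0),
     (7,0,1), (7,1,0), (7,1,5), (7,2,8), (7,4,9), (7,5,1), (7,8,2), (7,9,4), (7,9,10), (7,10,9),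
     (7,10,10), (8,0,6), (8,0,8), (8,1,9), (8,1,10), (8,2,3), (8,2,7), (8,3,2), (8,4,9), (8,6,0),
     (8,6,8), (8,7,2), (8,8,0), (8,8,6), (8,9,1), (8,9,4), (8,10,1), (9,0,2), (9,0,6), (9,1,2),
     (9,1,8), (9,2,0), (9,2,1), (9,3,5), (9,3,10), (9,4,7), (9,4,8), (9,5,3), (9,6,0), (9,7,4),
     (9,7,10), (9,8,1), (9,8,4), (9,9,9), (9,10,3), (9,10,7), (10,1,4), (10,1,8), (10,2,2), (10,2,4),
     (10,3,9), (10,3,10), (10,4,1), (10,4,2), (10,5,5), (10,5,6), (10,6,5), (10,7,9), (10,7,10), (10,8,1),
     (10,9,3), (10,9,7), (10,10,3), (10,10,7)]"

lemma distinct_directions_points7: "distinct_directions points7"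
  by code_simp

lemma distinct_directions_points8: "distinct_directions points8"
  by code_simp

lemma distinct_directions_points9: "distinct_directions points9"
  by code_simp

lemma distinct_directions_points10: "distinct_directions points10"
  by code_simp

lemma distinct_directions_points11: "distinct_directions points11"
  by code_simp

lemma points7_in_cube: "distinct points7" "list_all (in_cube 7) points7"
  by code_simp+

lemma points8_in_cube: "distinct points8" "list_all (in_cube 8) points8"
  by code_simp+

lemma points9_in_cube: "distinct points9" "list_all (in_cube 9) points9"
  by code_simp+

lemma points10_in_cube: "distinct points10" "list_all (in_cube 10) points10"
  by code_simp+

lemma points11_in_cube: "distinct points11" "list_all (in_cube 11) points11"
  by code_simp+

theorem mainTheorem2:
  "max_no_three_collinear 7 \<ge> 73 \<and>
   max_no_three_collinear 8 \<ge> 94 \<and>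
   max_no_three_collinear 9 \<ge> 116 \<and>
   max_no_three_collinear 10 \<ge> 138 \<and>
   max_no_three_collinear 11 \<ge> 164"
  using max_no_three_collinear_ge[OF distinct_directions_points7 points7_in_cube]
  using max_no_three_collinear_ge[OF distinct_directions_points8 points8_in_cube]
  using max_no_three_collinear_ge[OF distinct_directions_points9 points9_in_cube]
  using max_no_three_collinear_ge[OF distinct_directions_points10 points10_in_cube]
  using max_no_three_collinear_ge[OF distinct_directions_points11 points11_in_cube]
  by (simp add: points7_def points8_def points9_def points10_def points11_def)

end
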